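(* There is an absolute constant $c>0$ such that the following holds. Let $w$ and $N$ be integers with $0 < w < 2w \le N$. Let $R_x = [2w,N] \times [0,w]$ and $R_y = [0,w] \times [2w,N]$ (subsets of $\mathbb{R}^2$), and let $L = R_x \cup R_y$. Let $p(x,y)$ be a real bivariate polynomial of degree $d$ such that (1) $p(2w,2w) \ge 2$, and (2) $0 \le p(x,y) \le 1$ for all $(x,y) \in L \cap \mathbb{Z}^2$. Then $d \ge c\cdot\min\left\{\sqrt{w},\sqrt{N/w}\right\}$, i.e. $d = \Omega\left(\min\left\{\sqrt{w},\sqrt{N/w}\right\}\right)$.
   Context: The degree of a bivariate polynomial is its total degree. *)

theory Defs
  imports Complex_Main "HOL-Computational_Algebra.Polynomial"
begin

(* A bivariate polynomial is an element of R[x][y]: the coefficient of x^i y^j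
   in p is coeff (coeff p j) i. *)

definition total_degree :: "'a::zero poly poly \<Rightarrow> nat" where
  \<comment> \<open>the inserted 0 only matters for the zero polynomial, which gets degree 0\<close>
  "total_degree p = Max (insert 0 {i + j | i j. coeff (coeff p j) i \<noteq> 0})"

definition eval2 :: "'a::comm_semiring_0 poly poly \<Rightarrow> 'a \<Rightarrow> 'a \<Rightarrow> 'a" where
  "eval2 p x y = poly (poly p [:y:]) x"

lemma finite_total_degree_set: "finite {i + j | i j. coeff (coeff p j) i \<noteq> 0}"
proof -
  have "{i + j | i j. coeff (coeff p j) i \<noteq> 0}
      \<subseteq> (\<Union>j\<in>{..degree p}. (\<lambda>i. i + j) ` {..degree (coeff p j)})"
    by (force intro: le_degree)
  then show ?thesis
    by (rule finite_subset) auto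
qed

lemma eval2_altdef:
  fixes p :: "'a::comm_semiring_1 poly poly"
  shows "eval2 p x y = (\<Sum>j\<le>degree p. \<Sum>i\<le>degree (coeff p j). coeff (coeff p j) i * x ^ i * y ^ j)"
  by (simp add: eval2_def poly_altdef[of p] poly_sum poly_power poly_altdef[of "coeff p _"]
      sum_distrib_right)

definition R_x :: "int \<Rightarrow> int \<Rightarrow> (real \<times> real) set" where
  "R_x w N = {2 * real_of_int w..real_of_int N} \<times> {0..real_of_int w}"

definition R_y :: "int \<Rightarrow> int \<Rightarrow> (real \<times> real) set" where
  "R_y w N = {0..real_of_int w} \<times> {2 * real_of_int w..real_of_int N}"

definition L_region :: "int \<Rightarrow> int \<Rightarrow> (real \<times> real) set" where
  "L_region w N = R_x w N \<union> R_y w N"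

end

theory Submission
  imports Defs "HOL-Complex_Analysis.Complex_Analysis"
begin

text \<open>
  Suppose that the degree is a small multiple of the claimed bound. Markov's inequality, applied in
  one variable at a time, spreads the bound on \<open>p\<close> from the integer points of \<open>R_x\<close> and \<open>R_y\<close> to
  these rectangles. Both contain an arc of the hyperbola \<open>(2wt, 2w/t)\<close>, which passes through
  \<open>(2w, 2w)\<close> at \<open>t = 1\<close>. The sum of the values of \<open>p\<close> at the parameters \<open>t\<close> and \<open>1/t\<close> is a
  polynomial in \<open>s = t + 1/t\<close> of degree at most \<open>d\<close>. It is bounded for \<open>s\<close> between \<open>5/2\<close> and about
  \<open>N/(2w)\<close>, and it is large at \<open>s = 2\<close>, so that \<open>d\<close> must be of order \<open>sqrt (N/w)\<close> at least.
  Both the Markov inequality and the growth bound outside an interval come from the Bernstein-Walsh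
  inequality: a polynomial bounded by \<open>M\<close> on \<open>[-1, 1]\<close> is at most \<open>M / |v| ^ d\<close> at
  \<open>(v + 1/v) / 2\<close> for \<open>|v| \<le> 1\<close>.
\<close>

section \<open>Growth of polynomials outside the interval [-1, 1]\<close>

text \<open>The factor \<open>v ^ d\<close> cancels the pole at 0, so the product extends to an
  entire function \<open>g\<close>. On the unit circle \<open>(v + 1 / v) / 2\<close> is the real
  part of \<open>v\<close>, where the bound \<open>M\<close> applies, and the maximum modulus
  principle carries it into the disc.\<close>

lemma joukowski_bound:
  fixes r :: "complex poly"
  assumes deg: "degree r \<le> d"
    and bnd: "\<And>x. -1 \<le> x \<Longrightarrow> x \<le> 1 \<Longrightarrow> norm (poly r (of_real x)) \<le> M"
    and v: "v \<noteq> 0" "norm v \<le> 1"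
  shows "norm (poly r ((v + 1 / v) / 2)) * norm v ^ d \<le> M"
proof -
  define g where "g = (\<lambda>v::complex. \<Sum>i\<le>d. coeff r i / 2 ^ i * (v ^ (d - i) * (v\<^sup>2 + 1) ^ i))"
  have g_eq: "g v = poly r ((v + 1 / v) / 2) * v ^ d" if "v \<noteq> 0" for v
  proof -
    have "poly r ((v + 1 / v) / 2) = (\<Sum>i\<le>d. coeff r i * ((v + 1 / v) / 2) ^ i)"
      unfolding poly_altdef
      by (rule sum.mono_neutral_left) (use deg in \<open>auto simp: coeff_eq_0\<close>)
    moreover have "coeff r i * ((v + 1 / v) / 2) ^ i * v ^ d
        = coeff r i / 2 ^ i * (v ^ (d - i) * (v\<^sup>2 + 1) ^ i)" if "i \<le> d" for i
    proof -
      have "(v + 1 / v) / 2 * v = (v\<^sup>2 + 1) / 2"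
        using \<open>v \<noteq> 0\<close> by (simp add: field_simps power2_eq_square)
      then have "((v + 1 / v) / 2) ^ i * v ^ i = ((v\<^sup>2 + 1) / 2) ^ i"
        by (metis power_mult_distrib)
      moreover have "v ^ d = v ^ i * v ^ (d - i)"
        using that by (simp flip: power_add)
      ultimately show ?thesis
        by (simp add: power_divide mult.assoc)
    qed
    ultimately show ?thesis
      unfolding g_def sum_distrib_right by (simp add: sum_distrib_right)
  qed
  have "norm (g v) \<le> M"
  proof (rule maximum_modulus_frontier[of g "cball 0 1"])
    show "g holomorphic_on interior (cball 0 1)" "continuous_on (closure (cball 0 1)) g"
      unfolding g_def by (auto intro!: holomorphic_intros continuous_intros)
    fix z :: complex
    assume "z \<in> frontier (cball 0 1)"
    then have z: "norm z = 1"
      by simp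
    then have "z \<noteq> 0"
      by auto
    have "z * cnj z = 1"
      using z by (simp flip: complex_norm_square)
    then have "1 / z = cnj z"
      using \<open>z \<noteq> 0\<close> by (metis nonzero_mult_div_cancel_left)
    then have "(z + 1 / z) / 2 = of_real (Re z)"
      by (simp add: complex_add_cnj)
    moreover have "\<bar>Re z\<bar> \<le> 1"
      using abs_Re_le_cmod[of z] z by simp
    ultimately show "norm (g z) \<le> M"
      using bnd[of "Re z"] z by (simp add: g_eq[OF \<open>z \<noteq> 0\<close>] norm_mult norm_power abs_le_iff)
  qed (use v in auto)
  then show ?thesis
    using v by (simp add: g_eq norm_mult norm_power)
qed

text \<open>The two solutions \<open>v\<close> are reciprocal to each other, so one of them lies in
  the closed unit disc. The last equation says that circles about 0 are mapped to ellipses with foci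
  1 and -1.\<close>

lemma joukowski_preimage:
  fixes z :: complex
  obtains v where "v \<noteq> 0" "norm v \<le> 1" "(v + 1 / v) / 2 = z"
    "norm v + 1 / norm v = norm (z - 1) + norm (z + 1)"
proof -
  define u where "u = z + csqrt (z\<^sup>2 - 1)"
  have u: "u * (z - csqrt (z\<^sup>2 - 1)) = 1"
    using power2_csqrt[of "z\<^sup>2 - 1"] unfolding u_def
    by (simp add: algebra_simps power2_eq_square)
  then have "u \<noteq> 0" by auto
  with u have inv: "1 / u = z - csqrt (z\<^sup>2 - 1)"
    by (simp add: field_simps)
  define v where "v = (if norm u \<le> 1 then u else 1 / u)"
  have v0: "v \<noteq> 0" and v1: "norm v \<le> 1"
    using \<open>u \<noteq> 0\<close> by (auto simp: v_def norm_divide)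
  have "v + 1 / v = u + 1 / u"
    by (simp add: v_def)
  then have vz: "(v + 1 / v) / 2 = z"
    unfolding inv by (simp add: u_def)
  have "norm (z - 1) = norm ((v - 1)\<^sup>2) / (2 * norm v)"
  proof -
    have "z - 1 = (v - 1)\<^sup>2 / (2 * v)"
      using v0 by (simp flip: vz add: field_simps power2_eq_square)
    then show ?thesis by (simp add: norm_divide norm_mult)
  qed
  moreover have "norm (z + 1) = norm ((v + 1)\<^sup>2) / (2 * norm v)"
  proof -
    have "z + 1 = (v + 1)\<^sup>2 / (2 * v)"
      using v0 by (simp flip: vz add: field_simps power2_eq_square)
    then show ?thesis by (simp add: norm_divide norm_mult)
  qed
  \<comment> \<open>The parallelogram law for \<open>v\<close> and 1.\<close>
  moreover have "norm ((v - 1)\<^sup>2) + norm ((v + 1)\<^sup>2) = 2 * (norm v)\<^sup>2 + 2"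
    unfolding norm_power cmod_power2 by (simp add: power2_eq_square algebra_simps)
  ultimately have "norm (z - 1) + norm (z + 1) = (2 * (norm v)\<^sup>2 + 2) / (2 * norm v)"
    by (simp flip: add_divide_distrib)
  then have "norm v + 1 / norm v = norm (z - 1) + norm (z + 1)"
    using v0 by (simp add: field_simps power2_eq_square)
  with v0 v1 vz show ?thesis by (rule that)
qed

text \<open>On this ellipse the preimage \<open>v\<close> has \<open>1 / norm v\<close> at most
  \<open>1 + 3 * e\<close>: near the foci the Joukowski map is quadratic, so an excess of order
  \<open>e\<close> squared moves \<open>norm v\<close> away from 1 by order \<open>e\<close>
  only.\<close>

lemma poly_growth_ellipse:
  fixes r :: "complex poly"
  assumes deg: "degree r \<le> d"
    and bnd: "\<And>x. -1 \<le> x \<Longrightarrow> x \<le> 1 \<Longrightarrow> norm (poly r (of_real x)) \<le> M"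
    and e: "0 \<le> e" "e \<le> 1"
    and z: "norm (z - 1) + norm (z + 1) \<le> 2 + 2 * e\<^sup>2"
  shows "norm (poly r z) \<le> M * (1 + 3 * e) ^ d"
proof -
  obtain v where v: "v \<noteq> 0" "norm v \<le> 1" "(v + 1 / v) / 2 = z"
    "norm v + 1 / norm v = norm (z - 1) + norm (z + 1)"
    by (rule joukowski_preimage)
  have nv: "0 < norm v" using v by simp
  have "1 / norm v \<le> 1 + 3 * e"
  proof (rule ccontr)
    assume "\<not> ?thesis"
    then have less: "(1 + 3 * e) * norm v < 1"
      using nv by (simp add: field_simps)
    define n where "n = norm v"
    have "n * n + 1 \<le> (2 + 2 * e\<^sup>2) * n"
    proof -
      have "(n + 1 / n) * n \<le> (2 + 2 * e\<^sup>2) * n"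
        using v(4) z nv unfolding n_def by (intro mult_right_mono) auto
      then show ?thesis
        using nv by (simp add: n_def distrib_right)
    qed
    then have a: "(1 - n)\<^sup>2 \<le> 2 * e\<^sup>2 * n"
      by (simp add: power2_eq_square algebra_simps)
    have b: "3 * e * n < 1 - n" using less unfolding n_def by (simp add: algebra_simps)
    have "2 * e * (3 * e * n) \<le> 2 * e * (1 - n)"
      using b e by (intro mult_left_mono) auto
    moreover have n0: "0 < n" using nv n_def by simp
    ultimately have "3 * (1 - n)\<^sup>2 \<le> 2 * e * (1 - n)"
      using a by (simp add: power2_eq_square algebra_simps)
    moreover have "0 < 1 - n" using b e n0 by (smt (verit) mult_nonneg_nonneg)
    ultimately have "3 * (1 - n) \<le> 2 * e"
      by (simp add: power2_eq_square)
    \<comment> \<open>For positive \<open>e\<close> this gives \<open>n\<close> at most 2/9, whereas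
      the previous inequality and \<open>e\<close> at most 1 give \<open>n\<close> at least 1/3. For
      \<open>e = 0\<close> the previous inequality alone contradicts \<open>n < 1\<close>.\<close>
    moreover have "e * (9 * n) \<le> 2 * e" using b calculation by simp
    ultimately show False using b e n0 by (cases "e = 0") auto
  qed
  then have "(1 / norm v) ^ d \<le> (1 + 3 * e) ^ d"
    using nv by (intro power_mono) auto
  moreover have "norm (poly r z) \<le> M * (1 / norm v) ^ d"
    using joukowski_bound[OF deg bnd v(1,2)] v(3) nv by (simp add: field_simps)
  moreover have "0 \<le> M"
    using bnd[of 0] norm_ge_zero by (metis order_trans neg_le_0_iff_le zero_le_one)
  ultimately show ?thesis
    by (meson mult_left_mono order_trans)
qed

lemma one_plus_power_le_exp:
  fixes x :: real
  assumes "0 \<le> x"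
  shows "(1 + x) ^ d \<le> exp (real d * x)"
  using power_mono[OF exp_ge_add_one_self[of x], of d] assms
  by (simp add: exp_of_nat_mult)

lemma poly_of_real_map_poly: "poly (map_poly of_real r) (of_real x) = (of_real (poly r x) :: complex)"
  by (induction r) (auto simp: map_poly_pCons)

text \<open>The distances of this point from 1 and -1 add up to exactly the bound that defines the
  ellipse.\<close>

lemma poly_growth_right:
  fixes r :: "real poly"
  assumes "degree r \<le> d"
    and "\<And>x. -1 \<le> x \<Longrightarrow> x \<le> 1 \<Longrightarrow> \<bar>poly r x\<bar> \<le> M"
    and "0 \<le> e" "e \<le> 1"
  shows "\<bar>poly r (1 + e\<^sup>2)\<bar> \<le> M * (1 + 3 * e) ^ d"
proof -
  let ?z = "complex_of_real (1 + e\<^sup>2)"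
  have "norm (?z - 1) = e\<^sup>2" "norm (?z + 1) = 2 + e\<^sup>2"
    using norm_of_real[of "e\<^sup>2", where 'a = complex] norm_of_real[of "2 + e\<^sup>2", where 'a = complex]
    by (simp_all add: add.commute)
  then have "norm (poly (map_poly of_real r) ?z) \<le> M * (1 + 3 * e) ^ d"
    using assms by (intro poly_growth_ellipse) (auto simp: poly_of_real_map_poly intro: order_trans[OF map_poly_degree_leq])
  then show ?thesis
    by (simp only: poly_of_real_map_poly norm_of_real)
qed

section \<open>Markov's inequality and bounds from integer points\<close>

text \<open>Cauchy's estimate on the circle of radius \<open>1 / d^2\<close> about \<open>x\<close>.
  This circle lies in the ellipse with \<open>e = 1 / d\<close>, where the polynomial is at most
  \<open>M * (1 + 3 / d) ^ d\<close>, hence at most \<open>exp 3 * M\<close>.\<close>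

lemma markov_weak:
  fixes r :: "real poly"
  assumes deg: "degree r \<le> d"
    and bnd: "\<And>x. -1 \<le> x \<Longrightarrow> x \<le> 1 \<Longrightarrow> \<bar>poly r x\<bar> \<le> M"
    and x: "-1 \<le> x" "x \<le> 1"
  shows "\<bar>poly (pderiv r) x\<bar> \<le> 27 * (real d)\<^sup>2 * M"
proof (cases "d = 0")
  case True
  then show ?thesis
    using deg by (simp add: pderiv_eq_0_iff[THEN iffD2])
next
  case False
  let ?f = "map_poly complex_of_real r"
  define R where "R = (1 / real d)\<^sup>2"
  have R: "0 < R" using False by (simp add: R_def)
  have M: "0 \<le> M"
    using bnd[of 0] by simp
  have "norm ((deriv ^^ 1) (poly ?f) (of_real x)) \<le> fact 1 * (27 * M) / R ^ 1"
  proof (rule Cauchy_inequality)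
    fix z :: complex
    assume z: "norm (of_real x - z) = R"
    have "norm (z - 1) + norm (z + 1) \<le> 2 + 2 * (1 / real d)\<^sup>2"
    proof -
      have "norm (z - 1) \<le> norm (of_real x - z) + norm (complex_of_real x - 1)"
        using norm_triangle_ineq[of "z - of_real x" "of_real x - 1"]
        by (simp add: norm_minus_commute)
      moreover have "norm (z + 1) \<le> norm (of_real x - z) + norm (complex_of_real x + 1)"
        using norm_triangle_ineq[of "z - of_real x" "of_real x + 1"]
        by (simp add: norm_minus_commute)
      moreover have "norm (complex_of_real x - 1) = 1 - x" "norm (complex_of_real x + 1) = 1 + x"
        using x norm_of_real[of "x - 1", where 'a = complex] norm_of_real[of "x + 1", where 'a = complex]
        by simp_all
      ultimately show ?thesis
        using z by (simp add: R_def)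
    qed
    then have "norm (poly ?f z) \<le> M * (1 + 3 * (1 / real d)) ^ d"
      using deg bnd False by (intro poly_growth_ellipse) (auto simp: poly_of_real_map_poly intro: order_trans[OF map_poly_degree_leq])
    also have "(1 + 3 * (1 / real d)) ^ d \<le> 27"
    proof -
      have "(1 + 3 * (1 / real d)) ^ d \<le> exp (3 * 1)"
        using one_plus_power_le_exp[of "3 * (1 / real d)" d] False by simp
      also have "\<dots> = exp 1 ^ 3"
        using exp_of_nat_mult[of 3 "1::real"] by simp
      also have "\<dots> \<le> 3 ^ 3"
        by (intro power_mono exp_le) simp
      finally show ?thesis by simp
    qed
    finally show "norm (poly ?f z) \<le> 27 * M"
      using M by (simp add: mult_left_mono mult.commute[of 27])
  qed (use R in \<open>auto intro!: holomorphic_intros continuous_intros\<close>)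
  moreover have "deriv (poly ?f) (of_real x) = of_real (poly (pderiv r) x)"
  proof -
    have "pderiv ?f = map_poly of_real (pderiv r)"
      by (intro poly_eqI) (simp add: coeff_pderiv coeff_map_poly)
    then show ?thesis
      by (metis DERIV_imp_deriv poly_DERIV poly_of_real_map_poly)
  qed
  ultimately show ?thesis
    using False by (simp add: R_def field_simps)
qed

text \<open>Let the absolute value be largest at \<open>m\<close>. By Markov's inequality it can
  drop by at most 1/11 of this maximum on the way to a nearby integer, where \<open>B\<close>
  applies. So 10/11 of the maximum is at most \<open>B\<close>.\<close>

lemma poly_bound_from_integers:
  fixes r :: "real poly" and a b :: int
  assumes deg: "degree r \<le> d"
    and ab: "a < b" and d: "594 * (real d)\<^sup>2 \<le> of_int (b - a)"
    and bnd: "\<And>k. a \<le> k \<Longrightarrow> k \<le> b \<Longrightarrow> \<bar>poly r (of_int k)\<bar> \<le> B"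
    and x: "of_int a \<le> x" "x \<le> of_int b"
  shows "\<bar>poly r x\<bar> \<le> 11 / 10 * B"
proof -
  have "\<exists>m\<in>{of_int a..of_int b}. \<forall>y\<in>{of_int a..of_int b}. \<bar>poly r y\<bar> \<le> \<bar>poly r m\<bar>"
    using ab by (intro continuous_attains_sup) (auto intro!: continuous_intros)
  then obtain m where m: "of_int a \<le> m" "m \<le> of_int b"
    and max: "\<And>y. of_int a \<le> y \<Longrightarrow> y \<le> of_int b \<Longrightarrow> \<bar>poly r y\<bar> \<le> \<bar>poly r m\<bar>"
    by auto
  define l :: real where "l = of_int (b - a)"
  have l: "0 < l" using ab by (simp add: l_def)
  \<comment> \<open>The polynomial is transplanted to [-1, 1], where Markov's inequality is
    available.\<close>
  define s where "s = pcompose r [:of_int (a + b) / 2, l / 2:]"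
  have s_eq: "poly s ((2 * y - of_int (a + b)) / l) = poly r y" for y
    using l by (simp add: s_def poly_pcompose field_simps)
  have degs: "degree s \<le> d"
    using deg degree_pcompose_le[of r "[:of_int (a + b) / 2, l / 2:]"] l
    by (simp add: s_def)
  have s_bnd: "\<bar>poly s u\<bar> \<le> \<bar>poly r m\<bar>" if "-1 \<le> u" "u \<le> 1" for u
  proof -
    have "l * u \<le> l * 1" "l * (-1) \<le> l * u"
      using that l by (intro mult_left_mono; simp)+
    moreover have "real_of_int b = of_int a + l"
      "poly [:of_int (a + b) / 2, l / 2:] u = of_int a + l / 2 + l * u / 2"
      by (simp_all add: l_def field_simps)
    ultimately show ?thesis
      unfolding s_def poly_pcompose by (intro max) linarith+
  qed
  \<comment> \<open>Since \<open>a\<close> is an integer, rounding down does not leave the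
    interval.\<close>
  define k where "k = \<lfloor>m\<rfloor>"
  have k: "a \<le> k" "k \<le> b" "of_int k \<le> m" "m - of_int k \<le> 1"
    using m by (simp_all add: k_def le_floor_iff floor_le_iff) linarith+
  have kr: "real_of_int a \<le> of_int k" "real_of_int k \<le> of_int b"
    using k by simp_all
  have "\<bar>poly s ((2 * m - of_int (a + b)) / l) - poly s ((2 * of_int k - of_int (a + b)) / l)\<bar>
      \<le> 27 * (real d)\<^sup>2 * \<bar>poly r m\<bar> * \<bar>(2 * m - of_int (a + b)) / l - (2 * of_int k - of_int (a + b)) / l\<bar>"
  proof -
    have "norm (poly s u - poly s v) \<le> 27 * (real d)\<^sup>2 * \<bar>poly r m\<bar> * norm (u - v)"
      if "u \<in> {-1..1}" "v \<in> {-1..1}" for u v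
      by (rule field_differentiable_bound[where S = "{-1..1}" and f' = "poly (pderiv s)"])
        (use that markov_weak[OF degs s_bnd] in \<open>auto intro: DERIV_subset poly_DERIV\<close>)
    moreover have "(2 * y - of_int (a + b)) / l \<in> {-1..1}"
      if "of_int a \<le> y" "y \<le> of_int b" for y
      using that l by (auto simp: field_simps) (auto simp: l_def)
    ultimately show ?thesis
      using m kr by simp
  qed
  also have "(2 * m - of_int (a + b)) / l - (2 * of_int k - of_int (a + b)) / l = 2 * (m - of_int k) / l"
    by (simp flip: diff_divide_distrib)
  also have "\<bar>2 * (m - of_int k) / l\<bar> \<le> 2 / l"
    using k l by (simp add: abs_of_nonneg divide_right_mono)
  finally have "\<bar>poly r m - poly r (of_int k)\<bar> \<le> 27 * (real d)\<^sup>2 * \<bar>poly r m\<bar> * (2 / l)"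
    unfolding s_eq by (simp add: mult_left_mono)
  \<comment> \<open>The constant is 594 = 11 * 27 * 2.\<close>
  also have "\<dots> = (594 * (real d)\<^sup>2 / l) * (\<bar>poly r m\<bar> / 11)"
    by simp
  also have "\<dots> \<le> 1 * (\<bar>poly r m\<bar> / 11)"
    using d l by (intro mult_right_mono) (simp_all add: l_def)
  finally have "\<bar>poly r m\<bar> \<le> B + \<bar>poly r m\<bar> / 11"
    using bnd[OF k(1,2)] by linarith
  then show ?thesis
    using max[OF x] by linarith
qed

section \<open>Bivariate polynomials, one variable at a time\<close>

lemma coeff_eq_0_total_degree:
  assumes "total_degree p < i + j"
  shows "coeff (coeff p j) i = 0"
proof (rule ccontr)
  assume "coeff (coeff p j) i \<noteq> 0"
  then have "i + j \<le> total_degree p"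
    unfolding total_degree_def using finite_total_degree_set[of p] by (intro Max_ge) auto
  with assms show False by simp
qed

text \<open>Padding with zero coefficients makes both index ranges equal and independent of each
  other.\<close>

lemma eval2_sum:
  fixes p :: "'a::comm_semiring_1 poly poly"
  assumes "total_degree p \<le> d"
  shows "eval2 p x y = (\<Sum>j\<le>d. \<Sum>i\<le>d. coeff (coeff p j) i * x ^ i * y ^ j)"
proof -
  have deg: "degree (coeff p j) \<le> d" for j
    using assms by (intro degree_le) (auto intro!: coeff_eq_0_total_degree)
  have "degree p \<le> d"
    using assms by (intro degree_le) (auto intro!: poly_eqI coeff_eq_0_total_degree)
  have "eval2 p x y = (\<Sum>j\<le>degree p. \<Sum>i\<le>d. coeff (coeff p j) i * x ^ i * y ^ j)"
    unfolding eval2_altdef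
    by (intro sum.cong sum.mono_neutral_left) (use deg in \<open>auto simp: coeff_eq_0\<close>)
  also have "\<dots> = (\<Sum>j\<le>d. \<Sum>i\<le>d. coeff (coeff p j) i * x ^ i * y ^ j)"
    by (rule sum.mono_neutral_left) (use \<open>degree p \<le> d\<close> in \<open>auto simp: coeff_eq_0\<close>)
  finally show ?thesis .
qed

lemma eval2_as_poly_fst:
  fixes p :: "'a::comm_semiring_1 poly poly"
  obtains q where "degree q \<le> total_degree p" "\<And>x. poly q x = eval2 p x y"
proof
  let ?q = "\<Sum>j\<le>total_degree p. \<Sum>i\<le>total_degree p. monom (coeff (coeff p j) i * y ^ j) i"
  show "degree ?q \<le> total_degree p"
    by (intro degree_sum_le) (auto intro: order_trans[OF degree_monom_le])
  show "poly ?q x = eval2 p x y" for x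
    by (simp add: eval2_sum[OF order_refl] poly_sum poly_monom mult_ac)
qed

lemma eval2_as_poly_snd:
  fixes p :: "'a::comm_semiring_1 poly poly"
  obtains q where "degree q \<le> total_degree p" "\<And>y. poly q y = eval2 p x y"
proof
  let ?q = "\<Sum>j\<le>total_degree p. \<Sum>i\<le>total_degree p. monom (coeff (coeff p j) i * x ^ i) j"
  show "degree ?q \<le> total_degree p"
    by (intro degree_sum_le) (auto intro: order_trans[OF degree_monom_le])
  show "poly ?q y = eval2 p x y" for y
    by (simp add: eval2_sum[OF order_refl] poly_sum poly_monom)
qed

text \<open>The bound is extended first in \<open>x\<close> along the rows with integer
  \<open>j\<close>, then in \<open>y\<close> at a fixed real \<open>x\<close>; each pass costs a
  factor 11/10. The shift \<open>h\<close> allows for values centred away from 0.\<close>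

lemma eval2_bound_from_integers:
  fixes p :: "real poly poly" and a b a' b' :: int
  assumes ab: "a < b" "594 * (real (total_degree p))\<^sup>2 \<le> of_int (b - a)"
    and ab': "a' < b'" "594 * (real (total_degree p))\<^sup>2 \<le> of_int (b' - a')"
    and bnd: "\<And>i j. a \<le> i \<Longrightarrow> i \<le> b \<Longrightarrow> a' \<le> j \<Longrightarrow> j \<le> b' \<Longrightarrow>
      \<bar>eval2 p (of_int i) (of_int j) - h\<bar> \<le> B"
    and x: "of_int a \<le> x" "x \<le> of_int b" and y: "of_int a' \<le> y" "y \<le> of_int b'"
  shows "\<bar>eval2 p x y - h\<bar> \<le> (11 / 10)\<^sup>2 * B"
proof -
  have row: "\<bar>eval2 p x (of_int j) - h\<bar> \<le> 11 / 10 * B" if j: "a' \<le> j" "j \<le> b'" for j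
  proof -
    obtain q where q: "degree q \<le> total_degree p" "\<And>x. poly q x = eval2 p x (of_int j)"
      by (rule eval2_as_poly_fst[of p "of_int j"]) (rule that)
    have "degree (q - [:h:]) \<le> total_degree p"
      using q(1) by (intro degree_diff_le) auto
    then have "\<bar>poly (q - [:h:]) x\<bar> \<le> 11 / 10 * B"
      using ab x bnd[OF _ _ j] by (intro poly_bound_from_integers) (auto simp: q(2))
    then show ?thesis by (simp add: q(2))
  qed
  obtain q where q: "degree q \<le> total_degree p" "\<And>y. poly q y = eval2 p x y"
    by (rule eval2_as_poly_snd[of p x]) (rule that)
  have "degree (q - [:h:]) \<le> total_degree p"
    using q(1) by (intro degree_diff_le) auto
  then have "\<bar>poly (q - [:h:]) y\<bar> \<le> 11 / 10 * (11 / 10 * B)"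
    by (rule poly_bound_from_integers[of _ "total_degree p" a' b']) (use ab' y row in \<open>auto simp: q(2)\<close>)
  then show ?thesis by (simp add: q(2) power2_eq_square)
qed

section \<open>Symmetrization along a hyperbola\<close>

text \<open>The Vieta-Lucas polynomials, over the reals \<open>2 * T_n (s / 2)\<close> with the
  Chebyshev polynomial \<open>T_n\<close>. This normalization has integer coefficients and expresses
  \<open>t ^ n + 1 / t ^ n\<close> through \<open>t + 1 / t\<close>.\<close>

fun lucas_poly :: "nat \<Rightarrow> 'a::comm_ring_1 poly" where
  "lucas_poly 0 = [:2:]"
| "lucas_poly (Suc 0) = [:0, 1:]"
| "lucas_poly (Suc (Suc n)) = [:0, 1:] * lucas_poly (Suc n) - lucas_poly n"

lemma degree_lucas_poly: "degree (lucas_poly n :: 'a::comm_ring_1 poly) \<le> n"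
proof (induction n rule: lucas_poly.induct)
  case (3 n)
  have "degree ([:0, 1:] * lucas_poly (Suc n) :: 'a poly) \<le> Suc (Suc n)"
    using 3(1) degree_pCons_le[of "0 :: 'a" "lucas_poly (Suc n)"] by simp
  then show ?case
    using 3(2) unfolding lucas_poly.simps by (intro degree_diff_le) auto
qed auto

lemma poly_lucas_poly:
  fixes t :: "'a::field"
  assumes "t \<noteq> 0"
  shows "poly (lucas_poly n) (t + 1 / t) = t ^ n + 1 / t ^ n"
proof -
  define u where "u = 1 / t"
  have tu: "t * (u * x) = x" for x
    using assms by (simp add: u_def)
  have "poly (lucas_poly n) (t + u) = t ^ n + u ^ n"
    by (induction n rule: lucas_poly.induct) (simp_all add: algebra_simps tu)
  then show ?thesis
    by (simp add: u_def power_one_over)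
qed

text \<open>The index is the distance of \<open>i\<close> and \<open>j\<close>, written so that the
  subtraction of naturals never truncates.\<close>

lemma symmetrized_monomial_poly:
  fixes t :: "'a::field"
  assumes "t \<noteq> 0"
  shows "poly (lucas_poly (max i j - min i j)) (t + 1 / t) = t ^ i / t ^ j + t ^ j / t ^ i"
  by (cases i j rule: le_cases)
    (use assms in \<open>auto simp: poly_lucas_poly max_def min_def power_diff\<close>)

text \<open>At \<open>(c * t, c / t)\<close> the monomial with exponents \<open>i\<close> and
  \<open>j\<close> is a constant times \<open>t ^ i / t ^ j\<close>. Adding its mirror image gives a
  polynomial in \<open>t + 1 / t\<close> whose degree is at most the distance of \<open>i\<close>
  and \<open>j\<close>, so the degree does not double.\<close>

lemma eval2_hyperbola:
  fixes p :: "'a::field poly poly"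
  obtains Q where "degree Q \<le> total_degree p"
    "\<And>t. t \<noteq> 0 \<Longrightarrow> poly Q (t + 1 / t) = eval2 p (c * t) (c / t) + eval2 p (c / t) (c * t)"
proof
  let ?d = "total_degree p"
  let ?Q = "\<Sum>j\<le>?d. \<Sum>i\<le>?d. smult (coeff (coeff p j) i * c ^ i * c ^ j)
    (lucas_poly (max i j - min i j))"
  show "degree ?Q \<le> ?d"
    by (intro degree_sum_le)
      (auto intro!: order_trans[OF degree_smult_le] order_trans[OF degree_lucas_poly])
  show "poly ?Q (t + 1 / t) = eval2 p (c * t) (c / t) + eval2 p (c / t) (c * t)" if "t \<noteq> 0" for t
    unfolding eval2_sum[OF order_refl] poly_sum sum.distrib[symmetric] poly_smult
      symmetrized_monomial_poly[OF that]
    by (intro sum.cong) (use that in \<open>auto simp: power_mult_distrib power_divide field_simps\<close>)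
qed

section \<open>From growth along the hyperbola to the degree bound\<close>

text \<open>The orientation-reversing affine map from [-1, 1] onto [a, b] sends
  \<open>1 + e^2\<close> to the point in question.\<close>

lemma poly_growth_left_of_interval:
  fixes r :: "real poly"
  assumes deg: "degree r \<le> d"
    and bnd: "\<And>x. a \<le> x \<Longrightarrow> x \<le> b \<Longrightarrow> \<bar>poly r x\<bar> \<le> M"
    and ab: "a < b" and e: "0 \<le> e" "e \<le> 1"
  shows "\<bar>poly r (a - e\<^sup>2 * ((b - a) / 2))\<bar> \<le> M * (1 + 3 * e) ^ d"
proof -
  define h where "h = (b - a) / 2"
  have h: "0 < h" using ab by (simp add: h_def)
  let ?q = "pcompose r [:a + h, - h:]"
  have "\<bar>poly ?q (1 + e\<^sup>2)\<bar> \<le> M * (1 + 3 * e) ^ d"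
  proof (rule poly_growth_right[OF _ _ e])
    show "degree ?q \<le> d"
      using deg degree_pcompose_le[of r "[:a + h, - h:]"] h by simp
    fix u :: real
    assume "-1 \<le> u" "u \<le> 1"
    then have "h * u \<le> h * 1" "h * (-1) \<le> h * u"
      using h by (intro mult_left_mono; simp)+
    moreover have "b = a + 2 * h"
      by (simp add: h_def field_simps)
    moreover have "poly [:a + h, - h:] u = a + h - h * u"
      by simp
    ultimately show "\<bar>poly ?q u\<bar> \<le> M"
      unfolding poly_pcompose by (intro bnd) linarith+
  qed
  moreover have "poly ?q (1 + e\<^sup>2) = poly r (a - e\<^sup>2 * h)"
    by (simp add: poly_pcompose algebra_simps)
  ultimately show ?thesis by (simp add: h_def)
qed

text \<open>The value 5/2 is attained at \<open>t = 2\<close>, from where \<open>2 * w / t\<close>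
  is at most \<open>w\<close>.\<close>

lemma obtain_reciprocal_sum:
  fixes s T :: real
  assumes "2 \<le> T" "5 / 2 \<le> s" "s \<le> T + 1 / T"
  obtains t where "2 \<le> t" "t \<le> T" "t + 1 / t = s"
proof -
  have "\<exists>t\<ge>2. t \<le> T \<and> t + 1 / t = s"
    using assms by (intro IVT'[of "\<lambda>t. t + 1 / t"]) (auto intro!: continuous_intros)
  then show ?thesis using that by blast
qed

text \<open>Centring at 1/2 turns the range [0, 1] into the bound 1/2, which the two passes enlarge
  to \<open>(11 / 10)^2 / 2\<close>, that is 121/200.\<close>

lemma L_region_rectangle_bounds:
  fixes p :: "real poly poly" and w N :: int
  assumes w: "0 < w" "594 * (real (total_degree p))\<^sup>2 \<le> of_int w"
    and N: "2 * w < N" "594 * (real (total_degree p))\<^sup>2 \<le> of_int (N - 2 * w)"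
    and bnd: "\<And>x y. (x, y) \<in> L_region w N \<inter> (\<int> \<times> \<int>) \<Longrightarrow> 0 \<le> eval2 p x y \<and> eval2 p x y \<le> 1"
    and x: "2 * of_int w \<le> x" "x \<le> of_int N" and y: "0 \<le> y" "y \<le> of_int w"
  shows "\<bar>eval2 p x y - 1 / 2\<bar> \<le> 121 / 200" "\<bar>eval2 p y x - 1 / 2\<bar> \<le> 121 / 200"
proof -
  have abs_half: "\<bar>u - 1 / 2\<bar> \<le> 1 / 2" if "0 \<le> u \<and> u \<le> 1" for u :: real
    using that by linarith
  have "\<bar>eval2 p x y - 1 / 2\<bar> \<le> (11 / 10)\<^sup>2 * (1 / 2)"
  proof (rule eval2_bound_from_integers[of "2 * w" N _ 0 w])
    fix i j :: int
    assume "2 * w \<le> i" "i \<le> N" "0 \<le> j" "j \<le> w"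
    then have "2 * real_of_int w \<le> of_int i"
      by linarith
    then show "\<bar>eval2 p (of_int i) (of_int j) - 1 / 2\<bar> \<le> 1 / 2"
      using \<open>i \<le> N\<close> \<open>0 \<le> j\<close> \<open>j \<le> w\<close>
      by (intro abs_half bnd) (auto simp: L_region_def R_x_def)
  qed (use w N x y in simp_all)
  then show "\<bar>eval2 p x y - 1 / 2\<bar> \<le> 121 / 200"
    by (simp add: power2_eq_square)
  have "\<bar>eval2 p y x - 1 / 2\<bar> \<le> (11 / 10)\<^sup>2 * (1 / 2)"
  proof (rule eval2_bound_from_integers[of 0 w _ "2 * w" N])
    fix j i :: int
    assume "2 * w \<le> i" "i \<le> N" "0 \<le> j" "j \<le> w"
    then have "2 * real_of_int w \<le> of_int i"
      by linarith
    then show "\<bar>eval2 p (of_int j) (of_int i) - 1 / 2\<bar> \<le> 1 / 2"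
      using \<open>i \<le> N\<close> \<open>0 \<le> j\<close> \<open>j \<le> w\<close>
      by (intro abs_half bnd) (auto simp: L_region_def R_y_def)
  qed (use w N x y in simp_all)
  then show "\<bar>eval2 p y x - 1 / 2\<bar> \<le> 121 / 200"
    by (simp add: power2_eq_square)
qed

text \<open>The symmetrized polynomial minus 1 is at most 121/100 in absolute value on [5/2, S], but
  at least 3 at 2. The gap 1/2 is tiny against the length of the interval, so such growth forces a
  large degree.\<close>

lemma degree_ge_sqrt_ratio:
  fixes p :: "real poly poly" and w N :: real
  assumes w: "0 < w" and N: "100 * w \<le> N"
    and big: "2 \<le> eval2 p (2 * w) (2 * w)"
    and bnd: "\<And>x y. 2 * w \<le> x \<Longrightarrow> x \<le> N \<Longrightarrow> 0 \<le> y \<Longrightarrow> y \<le> w \<Longrightarrow>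
      \<bar>eval2 p x y - 1 / 2\<bar> \<le> 121 / 200 \<and> \<bar>eval2 p y x - 1 / 2\<bar> \<le> 121 / 200"
  shows "sqrt (N / w) \<le> 12 * real (total_degree p)"
proof -
  let ?d = "total_degree p"
  obtain Q where Q: "degree Q \<le> ?d"
    "\<And>t. t \<noteq> 0 \<Longrightarrow> poly Q (t + 1 / t) = eval2 p (2 * w * t) (2 * w / t) + eval2 p (2 * w / t) (2 * w * t)"
    by (rule eval2_hyperbola[of p "2 * w"]) (rule that)
  \<comment> \<open>The parameter at which the hyperbola reaches abscissa \<open>N\<close>.\<close>
  define T where "T = N / (2 * w)"
  define S where "S = T + 1 / T"
  have T: "50 \<le> T" using w N by (simp add: T_def field_simps)
  then have S: "T \<le> S" by (simp add: S_def)
  \<comment> \<open>Chosen so that the growth bound for [5/2, S] is evaluated exactly at 2.\<close>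
  define e where "e = 1 / sqrt (S - 5 / 2)"
  have e2: "e\<^sup>2 = 1 / (S - 5 / 2)"
    using S T by (simp add: e_def power_divide)
  have e: "0 \<le> e" "e \<le> 1"
    using S T by (simp_all add: e_def)
  have "\<bar>poly (Q - [:1:]) (5 / 2 - e\<^sup>2 * ((S - 5 / 2) / 2))\<bar> \<le> 121 / 100 * (1 + 3 * e) ^ ?d"
  proof (rule poly_growth_left_of_interval[OF _ _ _ e])
    show "degree (Q - [:1:]) \<le> ?d"
      using Q(1) by (intro degree_diff_le) auto
    fix s
    assume "5 / 2 \<le> s" "s \<le> S"
    then obtain t where t: "2 \<le> t" "t \<le> T" "t + 1 / t = s"
      using T obtain_reciprocal_sum[of T s] unfolding S_def by auto
    have "2 * w * t \<le> N"
      using t(2) w by (simp add: T_def field_simps)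
    moreover have "2 * w / t \<le> w" "0 \<le> 2 * w / t" "2 * w \<le> 2 * w * t"
      using t(1) w by (simp_all add: field_simps)
    ultimately have "\<bar>eval2 p (2 * w * t) (2 * w / t) - 1 / 2\<bar> \<le> 121 / 200"
      "\<bar>eval2 p (2 * w / t) (2 * w * t) - 1 / 2\<bar> \<le> 121 / 200"
      using bnd by blast+
    then show "\<bar>poly (Q - [:1:]) s\<bar> \<le> 121 / 100"
      using Q(2)[of t] t by (simp add: abs_if split: if_splits)
  qed (use S T in simp)
  moreover have "5 / 2 - e\<^sup>2 * ((S - 5 / 2) / 2) = 2"
    using S T by (simp add: e2)
  \<comment> \<open>At \<open>t = 1\<close> both summands are the value at
    \<open>(2 * w, 2 * w)\<close>.\<close>
  moreover have "3 \<le> poly (Q - [:1:]) 2"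
    using Q(2)[of 1] big by simp
  ultimately have "3 \<le> 121 / 100 * (1 + 3 * e) ^ ?d"
    by simp
  then have "2 < (1 + 3 * e) ^ ?d" by simp
  also have "\<dots> \<le> exp (real ?d * (3 * e))"
    using e by (intro one_plus_power_le_exp) simp
  finally have "exp (1 / 2) < exp (real ?d * (3 * e))"
    using exp_half_le2 by linarith
  then have "1 < 6 * real ?d * e" by simp
  then have "sqrt (S - 5 / 2) < 6 * real ?d"
    using S T by (simp add: e_def field_simps)
  moreover have "N / w / 4 \<le> S - 5 / 2"
  proof -
    have "N / w / 4 = T / 2" by (simp add: T_def)
    then show ?thesis using S T by simp
  qed
  then have "sqrt (N / w) / 2 \<le> sqrt (S - 5 / 2)"
    using real_sqrt_le_mono[of "N / w / 4" "S - 5 / 2"] by (simp add: real_sqrt_divide real_sqrt_mult)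
  ultimately show ?thesis by simp
qed

lemma eval2_total_degree_0:
  fixes p :: "'a::comm_semiring_1 poly poly"
  assumes "total_degree p = 0"
  shows "eval2 p x y = coeff (coeff p 0) 0"
  using eval2_sum[of p 0 x y] assms by simp

text \<open>If the bound fails, both \<open>w\<close> and \<open>N / w\<close> exceed 1000000 times
  the squared degree. This is ample for the passage from integers to rectangles, and the resulting
  estimate \<open>sqrt (N / w)\<close> at most 12 times the degree is contradictory.\<close>

lemma total_degree_lower_bound:
  fixes p :: "real poly poly" and w N :: int
  assumes w: "0 < w" and N: "2 * w \<le> N"
    and big: "2 \<le> eval2 p (2 * real_of_int w) (2 * real_of_int w)"
    and bnd: "\<And>x y. (x, y) \<in> L_region w N \<inter> (\<int> \<times> \<int>) \<Longrightarrow> 0 \<le> eval2 p x y \<and> eval2 p x y \<le> 1"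
  shows "1 / 1000 * min (sqrt (of_int w)) (sqrt (of_int N / of_int w)) \<le> real (total_degree p)"
proof (rule ccontr)
  let ?d = "real (total_degree p)"
  assume "\<not> ?thesis"
  then have less_w: "1000 * ?d < sqrt (of_int w)" and less_N: "1000 * ?d < sqrt (of_int N / of_int w)"
    by simp_all
  \<comment> \<open>A constant cannot be at least 2 at \<open>(2 * w, 2 * w)\<close> and at most 1
    at \<open>(2 * w, 0)\<close>. Degree at least 1 is what makes \<open>N / w\<close> exceed an
    absolute constant below.\<close>
  have "total_degree p \<noteq> 0"
  proof
    assume "total_degree p = 0"
    then have "eval2 p (2 * real_of_int w) 0 \<ge> 2"
      using big by (simp add: eval2_total_degree_0)
    moreover have "eval2 p (2 * real_of_int w) 0 \<le> 1"
      using w N bnd[of "2 * of_int w" 0] by (auto simp: L_region_def R_x_def)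
    ultimately show False by simp
  qed
  then have d: "1 \<le> ?d" by simp
  have sq: "1000000 * ?d\<^sup>2 < u" if "1000 * ?d < sqrt u" for u
  proof -
    have "\<not> u \<le> (1000 * ?d)\<^sup>2"
      using that real_le_lsqrt[of "1000 * ?d" u] d by auto
    then show ?thesis by (simp add: power_mult_distrib)
  qed
  have d2: "1 \<le> ?d\<^sup>2" using d by simp
  have w': "1000000 * ?d\<^sup>2 < of_int w"
    using less_w by (rule sq)
  have "1000000 < real_of_int N / of_int w"
    using sq[OF less_N] d2 by linarith
  then have N': "1000000 * real_of_int w < of_int N"
    using w by (simp add: field_simps)
  then have N2: "2 * w < N" using w by linarith
  have "sqrt (of_int N / of_int w) \<le> 12 * ?d"
  proof (rule degree_ge_sqrt_ratio[OF _ _ big])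
    fix x y :: real
    assume "2 * of_int w \<le> x" "x \<le> of_int N" "0 \<le> y" "y \<le> of_int w"
    moreover have "594 * ?d\<^sup>2 \<le> of_int w" "594 * ?d\<^sup>2 \<le> of_int (N - 2 * w)"
      using w' N' d2 by simp_all
    ultimately show "\<bar>eval2 p x y - 1 / 2\<bar> \<le> 121 / 200 \<and> \<bar>eval2 p y x - 1 / 2\<bar> \<le> 121 / 200"
      using L_region_rectangle_bounds w N2 bnd by blast
  qed (use w N' in simp_all)
  with less_N d show False by simp
qed

theorem theorem1:
  shows "\<exists>c::real. c > 0 \<and>
    (\<forall>(w::int) (N::int) (p::real poly poly) (d::nat).
      0 < w \<longrightarrow> w < 2 * w \<longrightarrow> 2 * w \<le> N \<longrightarrow>
      total_degree p = d \<longrightarrow>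
      eval2 p (2 * real_of_int w) (2 * real_of_int w) \<ge> 2 \<longrightarrow>
      (\<forall>(x, y) \<in> L_region w N \<inter> (\<int> \<times> \<int>). 0 \<le> eval2 p x y \<and> eval2 p x y \<le> 1) \<longrightarrow>
      real d \<ge> c * min (sqrt (real_of_int w)) (sqrt (real_of_int N / real_of_int w)))"
proof (intro exI[of _ "1 / 1000"] conjI allI impI)
  fix w N :: int and p :: "real poly poly" and d :: nat
  assume "0 < w" "2 * w \<le> N" "total_degree p = d"
    and "eval2 p (2 * real_of_int w) (2 * real_of_int w) \<ge> 2"
    and "\<forall>(x, y) \<in> L_region w N \<inter> (\<int> \<times> \<int>). 0 \<le> eval2 p x y \<and> eval2 p x y \<le> 1"
  then show "1 / 1000 * min (sqrt (real_of_int w)) (sqrt (real_of_int N / real_of_int w)) \<le> real d"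
    using total_degree_lower_bound[of w N p] by blast
qed simp

end
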